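(* Let $m$ and $F$ be positive integers such that $m<F$ and $m\nmid F$, and let $S\in\mathscr{R}(F,m)$. Then the set of children of $S$ in the tree $\mathrm{G}(\mathscr{R}(F,m))$ is $$\{S\cup\{x\}\mid x\in\mathrm{SG}(S),\ m<x<\mathrm{r}(S)\ \text{and}\ x\neq F\}.$$
   Context: $\mathbb{N}$ is the set of nonnegative integers. A numerical semigroup is a submonoid $S$ of $(\mathbb{N},+)$ with $\mathbb{N}\setminus S$ finite. Its Frobenius number $\mathrm{F}(S)$ is the largest integer not in $S$, and its multiplicity is $\mathrm{m}(S)=\min(S\setminus\{0\})$. If $S\neq\mathbb{N}$, the ratio of $S$ is $\mathrm{r}(S)=\min\{s\in S\mid \mathrm{m}(S)\nmid s\}$ (equivalently, the smallest minimal generator of $S$ different from $\mathrm{m}(S)$). $\mathscr{R}(F,m)$ denotes the set of numerical semigroups $S$ with $\mathrm{F}(S)=F$ and $\mathrm{m}(S)=m$. $\mathrm{G}(\mathscr{R}(F,m))$ is the graph with vertex set $\mathscr{R}(F,m)$ in which a pair $(S,T)$ of elements of $\mathscr{R}(F,m)$ is an edge if and only if $T=S\setminus\{\mathrm{r}(S)\}$; it is a tree with root $\langle m\rangle\cup\{n\in\mathbb{N}\mid n\ge F+1\}$, where $\langle m\rangle$ is the set of nonnegative multiples of $m$. If $(u,v)$ is an edge, $u$ is called a child of $v$. For a numerical semigroup $S$, the set of pseudo-Frobenius numbers is $\mathrm{PF}(S)=\{z\in\mathbb{Z}\setminus S\mid z+s\in S\text{ for all }s\in S\setminus\{0\}\}$,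 and the set of special gaps is $\mathrm{SG}(S)=\{x\in\mathrm{PF}(S)\mid 2x\in S\}$. *)

theory Defs
  imports "Graph_Theory.Pair_Digraph"
begin

definition numerical_semigroup :: "nat set \<Rightarrow> bool" where
  "numerical_semigroup S \<longleftrightarrow>
     0 \<in> S \<and> (\<forall>a\<in>S. \<forall>b\<in>S. a + b \<in> S) \<and> finite (UNIV - S)"

text \<open>
  The Frobenius number is an integer because it is \<open>-1\<close> for the semigroup of all
  natural numbers.
\<close>

definition frobenius :: "nat set \<Rightarrow> int" where
  "frobenius S = (GREATEST z. z \<notin> int ` S)"

definition mult :: "nat set \<Rightarrow> nat" where
  "mult S = (LEAST s. s \<in> S - {0})"

text \<open>Unspecified if \<open>S = UNIV\<close>, where every element is a multiple of \<open>mult S = 1\<close>.\<close>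

definition ratio :: "nat set \<Rightarrow> nat" where
  "ratio S = (LEAST s. s \<in> S \<and> \<not> mult S dvd s)"

definition semigroups_FM :: "nat \<Rightarrow> nat \<Rightarrow> nat set set" where
  "semigroups_FM F m =
     {S. numerical_semigroup S \<and> frobenius S = int F \<and> mult S = m}"

text \<open>The pair \<open>(S, T)\<close> is an arc from the child \<open>S\<close> to its parent \<open>T\<close>.\<close>

definition graph_FM :: "nat \<Rightarrow> nat \<Rightarrow> nat set pair_pre_digraph" where
  "graph_FM F m =
     \<lparr> pverts = semigroups_FM F m,
       parcs = {(S, T). S \<in> semigroups_FM F m \<and> T \<in> semigroups_FM F m
                        \<and> T = S - {ratio S}} \<rparr>"

definition children :: "'a pair_pre_digraph \<Rightarrow> 'a \<Rightarrow> 'a set" where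
  "children G v = {u. (u, v) \<in> parcs G}"

definition pseudo_frobenius :: "nat set \<Rightarrow> int set" where
  "pseudo_frobenius S = {z. z \<notin> int ` S \<and> (\<forall>s \<in> S - {0}. z + int s \<in> int ` S)}"

definition special_gaps :: "nat set \<Rightarrow> int set" where
  "special_gaps S = {x \<in> pseudo_frobenius S. 2 * x \<in> int ` S}"

end

theory Submission
  imports Defs
begin

text \<open>
  Removing the ratio of a child and adjoining a suitable gap to the parent are mutually inverse.

  If \<open>S = T - {r}\<close> with \<open>r\<close> the ratio of \<open>T\<close>, then \<open>T = S \<union> {r}\<close>. For a gap \<open>x > 0\<close> of \<open>S\<close>,
  the set \<open>S \<union> {x}\<close> is a semigroup exactly when \<open>x\<close> is a special gap
  (\<open>numerical_semigroup_insert_iff\<close>), because the only new sums are \<open>x + s\<close> and \<open>2 * x\<close>. The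
  three inequalities then express that the invariants are the right ones: \<open>x \<noteq> F\<close> keeps the
  Frobenius number, \<open>m < x\<close> keeps the multiplicity, and \<open>x < ratio S\<close> makes \<open>x\<close> the ratio of
  \<open>S \<union> {x}\<close>, since a gap of \<open>S\<close> is never a multiple of \<open>m\<close>.

  The invariants are defined by \<open>LEAST\<close> and \<open>GREATEST\<close>, so each is first shown to be attained.
\<close>

text \<open>
  A greatest integer outside \<open>S\<close> exists, so \<open>GREATEST\<close> attains it: it is the maximum of the finitely many gaps together
  with \<open>-1\<close>, the largest negative integer.
\<close>

lemma frobenius_eq_iff:
  assumes "numerical_semigroup S"
  shows "frobenius S = int F \<longleftrightarrow> F \<notin> S \<and> (\<forall>n>F. n \<in> S)"
proof
  define A where "A = insert (-1) (int ` (UNIV - S))"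
  have fin: "finite A"
    using assms by (simp add: A_def numerical_semigroup_def)
  have "Max A \<in> A"
    using fin by (intro Max_in) (auto simp: A_def)
  then have "Max A \<notin> int ` S"
    by (auto simp: A_def)
  moreover have "z \<le> Max A" if "z \<notin> int ` S" for z
  proof (cases "z < 0")
    case True
    moreover have "- 1 \<le> Max A"
      using fin by (intro Max_ge) (auto simp: A_def)
    ultimately show ?thesis by linarith
  next
    case False
    then obtain n where "z = int n"
      using nonneg_int_cases by (metis not_less)
    then have "z \<in> A"
      using that by (auto simp: A_def)
    then show ?thesis
      using fin by simp
  qed
  ultimately have gap: "frobenius S \<notin> int ` S"
    and above: "z \<notin> int ` S \<Longrightarrow> z \<le> frobenius S" for z
    using Greatest_equality[of "\<lambda>z. z \<notin> int ` S" "Max A"]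
    by (simp_all add: frobenius_def)
  assume eq: "frobenius S = int F"
  have "n \<in> S" if "n > F" for n
    using above[of "int n"] eq that by (cases "int n \<in> int ` S") auto
  then show "F \<notin> S \<and> (\<forall>n>F. n \<in> S)"
    using gap eq by auto
next
  assume F: "F \<notin> S \<and> (\<forall>n>F. n \<in> S)"
  show "frobenius S = int F"
    unfolding frobenius_def
  proof (rule Greatest_equality)
    show "int F \<notin> int ` S"
      using F by auto
    show "z \<le> int F" if "z \<notin> int ` S" for z
    proof (rule ccontr)
      assume "\<not> z \<le> int F"
      then have "nat z \<in> S" "z = int (nat z)"
        using F by auto
      then show False
        using that by blast
    qed
  qed
qed

lemma mult_in:
  assumes "numerical_semigroup S"
  shows "mult S \<in> S" and "mult S > 0"
proof -
  have "infinite S"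
    using assms by (metis infinite_UNIV_nat finite_Diff2 numerical_semigroup_def)
  then have "\<exists>s. s \<in> S - {0}"
    by (metis finite.emptyI infinite_remove ex_in_conv)
  then have "mult S \<in> S - {0}"
    unfolding mult_def by (rule LeastI_ex)
  then show "mult S \<in> S" "mult S > 0"
    by auto
qed

lemma mult_le:
  assumes "s \<in> S" and "s > 0"
  shows "mult S \<le> s"
  unfolding mult_def using assms by (intro Least_le) auto

lemma mult_multiple_in:
  assumes "numerical_semigroup S" and "mult S dvd n"
  shows "n \<in> S"
proof -
  have "mult S * k \<in> S" for k
    using assms(1) mult_in(1)[OF assms(1)]
    by (induction k) (auto simp: numerical_semigroup_def)
  then show ?thesis
    using assms(2) by (auto elim: dvdE)
qed

text \<open>
  Of two consecutive integers past the last gap, at most one is a multiple of \<open>mult S\<close> when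
  \<open>mult S \<noteq> 1\<close>, so some element of \<open>S\<close> is not.
\<close>

lemma ratio_in:
  assumes S: "numerical_semigroup S" and "mult S \<noteq> 1"
  shows "ratio S \<in> S" and "\<not> mult S dvd ratio S"
proof -
  have "finite (UNIV - S)"
    using S by (simp add: numerical_semigroup_def)
  then obtain N where N: "n \<le> N" if "n \<notin> S" for n
    unfolding finite_nat_set_iff_bounded_le by blast
  have "Suc N \<in> S" "Suc (Suc N) \<in> S"
    using N by (meson Suc_n_not_le_n Suc_leD)+
  moreover have "\<not> (mult S dvd Suc N \<and> mult S dvd Suc (Suc N))"
    using assms(2) dvd_diff_nat[of "mult S" "Suc (Suc N)" "Suc N"] by auto
  ultimately have "\<exists>s. s \<in> S \<and> \<not> mult S dvd s"
    by blast
  then have "ratio S \<in> S \<and> \<not> mult S dvd ratio S"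
    unfolding ratio_def by (rule LeastI_ex)
  then show "ratio S \<in> S" "\<not> mult S dvd ratio S"
    by auto
qed

lemma ratio_le:
  assumes "s \<in> S" and "\<not> mult S dvd s"
  shows "ratio S \<le> s"
  unfolding ratio_def using assms by (intro Least_le) auto

lemma special_gap_iff:
  "int x \<in> special_gaps S \<longleftrightarrow> x \<notin> S \<and> (\<forall>s\<in>S - {0}. x + s \<in> S) \<and> 2 * x \<in> S"
proof -
  have "int x + int s \<in> int ` S \<longleftrightarrow> x + s \<in> S" for s
    by (metis inj_image_mem_iff inj_of_nat of_nat_add)
  moreover have "2 * int x \<in> int ` S \<longleftrightarrow> 2 * x \<in> S"
    by (metis inj_image_mem_iff inj_of_nat of_nat_mult of_nat_numeral)
  ultimately show ?thesis
    unfolding special_gaps_def pseudo_frobenius_def by (auto simp: inj_image_mem_iff)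
qed

text \<open>
  The sums that adjoining \<open>x\<close> creates are \<open>x + s\<close> and \<open>2 * x\<close>. For \<open>s > 0\<close> and \<open>x > 0\<close> they
  differ from \<open>x\<close>, so closure forces them into \<open>S\<close> itself.
\<close>

lemma numerical_semigroup_insert_iff:
  assumes S: "numerical_semigroup S" and "x \<notin> S"
  shows "numerical_semigroup (S \<union> {x}) \<longleftrightarrow> int x \<in> special_gaps S"
proof
  assume T: "numerical_semigroup (S \<union> {x})"
  have "x > 0"
    using assms by (metis gr0I numerical_semigroup_def)
  moreover have "x + s \<in> S \<union> {x}" if "s \<in> S \<union> {x}" for s
    using T that unfolding numerical_semigroup_def by blast
  ultimately have "x + s \<in> S" if "s \<in> S \<union> {x}" "s > 0" for s
    using that by fastforce
  then show "int x \<in> special_gaps S"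
    using \<open>x > 0\<close> \<open>x \<notin> S\<close> unfolding special_gap_iff by (auto simp: mult_2)
next
  assume x: "int x \<in> special_gaps S"
  have add: "x + s \<in> S \<union> {x}" if "s \<in> S" for s
    using x that unfolding special_gap_iff by (cases "s = 0") auto
  have "a + b \<in> S \<union> {x}" if "a \<in> S \<union> {x}" "b \<in> S \<union> {x}" for a b
  proof -
    consider "a \<in> S" "b \<in> S" | "a = x" "b \<in> S" | "a \<in> S" "b = x" | "a = x" "b = x"
      using \<open>a \<in> S \<union> {x}\<close> \<open>b \<in> S \<union> {x}\<close> by blast
    then show ?thesis
    proof cases
      case 1
      then show ?thesis using S by (simp add: numerical_semigroup_def)
    next
      case 2
      then show ?thesis using add by simp
    next
      case 3
      then show ?thesis using add[of a] by (simp add: add.commute)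
    next
      case 4
      then show ?thesis using x by (simp add: special_gap_iff mult_2)
    qed
  qed
  moreover have "finite (UNIV - (S \<union> {x}))"
    using S by (auto simp: numerical_semigroup_def intro: finite_subset[of _ "UNIV - S"])
  ultimately show "numerical_semigroup (S \<union> {x})"
    using S by (simp add: numerical_semigroup_def)
qed

lemma mult_insert:
  assumes S: "numerical_semigroup S" and "mult S < x"
  shows "mult (S \<union> {x}) = mult S"
  unfolding mult_def[of "S \<union> {x}"]
proof (rule Least_equality)
  show "mult S \<in> S \<union> {x} - {0}"
    using mult_in[OF S] by simp
  show "mult S \<le> s" if "s \<in> S \<union> {x} - {0}" for s
    using that mult_le[of s S] assms(2) by auto
qed

lemma ratio_insert:
  assumes S: "numerical_semigroup S" and "x \<notin> S" and "mult S < x" and "x < ratio S"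
  shows "ratio (S \<union> {x}) = x"
  unfolding ratio_def[of "S \<union> {x}"] mult_insert[OF S \<open>mult S < x\<close>]
proof (rule Least_equality)
  show "x \<in> S \<union> {x} \<and> \<not> mult S dvd x"
    using mult_multiple_in[OF S] \<open>x \<notin> S\<close> by auto
  show "x \<le> s" if "s \<in> S \<union> {x} \<and> \<not> mult S dvd s" for s
    using that ratio_le[of s S] \<open>x < ratio S\<close> by auto
qed

theorem proposition3p4:
  fixes m F :: nat and S :: "nat set"
  assumes "0 < m" and "0 < F" and "m < F" and "\<not> m dvd F"
    and "S \<in> semigroups_FM F m"
  shows "children (graph_FM F m) S =
           {S \<union> {x} | x. int x \<in> special_gaps S \<and> m < x \<and> x < ratio S \<and> x \<noteq> F}"
proof -
  have S: "numerical_semigroup S" and FS: "frobenius S = int F" and mS: "mult S = m"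
    using assms(5) by (auto simp: semigroups_FM_def)
  have m1: "m \<noteq> 1"
    using assms(4) by auto
  have children: "children (graph_FM F m) S = {T \<in> semigroups_FM F m. S = T - {ratio T}}"
    using assms(5) by (auto simp: children_def graph_FM_def)
  have "\<exists>x. T = S \<union> {x} \<and> int x \<in> special_gaps S \<and> m < x \<and> x < ratio S \<and> x \<noteq> F"
    if T_in: "T \<in> semigroups_FM F m" and ST: "S = T - {ratio T}" for T
  proof (intro exI conjI)
    have T: "numerical_semigroup T" and FT: "frobenius T = int F" and mT: "mult T = m"
      using T_in by (auto simp: semigroups_FM_def)
    have r: "ratio T \<in> T" "\<not> m dvd ratio T"
      using ratio_in[OF T] mT m1 by auto
    show eq: "T = S \<union> {ratio T}"
      using ST r(1) by auto
    show "int (ratio T) \<in> special_gaps S"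
      using numerical_semigroup_insert_iff[OF S, of "ratio T"] T eq ST by auto
    have "ratio T > 0"
      using r(2) by (metis dvd_0_right gr0I)
    then have "m \<le> ratio T"
      using mult_le r(1) mT by blast
    then show "m < ratio T"
      using r(2) by (metis dvd_refl le_neq_implies_less)
    have rS: "ratio S \<in> S" "\<not> m dvd ratio S"
      using ratio_in[OF S] mS m1 by auto
    then have "ratio T \<le> ratio S"
      using ST mT by (intro ratio_le) auto
    moreover have "ratio S \<noteq> ratio T"
      using rS(1) ST by auto
    ultimately show "ratio T < ratio S"
      by simp
    show "ratio T \<noteq> F"
      using r(1) frobenius_eq_iff[OF T] FT by auto
  qed
  moreover have "S \<union> {x} \<in> semigroups_FM F m" and "S = S \<union> {x} - {ratio (S \<union> {x})}"
    if x: "int x \<in> special_gaps S" "m < x" "x < ratio S" "x \<noteq> F" for x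
  proof -
    have gap: "x \<notin> S"
      using x(1) by (simp add: special_gap_iff)
    have T: "numerical_semigroup (S \<union> {x})"
      using numerical_semigroup_insert_iff[OF S gap] x(1) by simp
    have "frobenius (S \<union> {x}) = int F"
      using frobenius_eq_iff[OF T] frobenius_eq_iff[OF S] FS x(4) by auto
    then show "S \<union> {x} \<in> semigroups_FM F m"
      using T mult_insert[OF S] mS x(2) by (simp add: semigroups_FM_def)
    show "S = S \<union> {x} - {ratio (S \<union> {x})}"
      using ratio_insert[OF S gap] mS x(2,3) gap by auto
  qed
  ultimately show ?thesis
    unfolding children by blast
qed

end
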